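(* Let $A\in\mathbb{R}^{d\times d}$ be real symmetric with eigenvalues $\lambda_1\ge\lambda_2\ge\dots\ge\lambda_{r-1}>\lambda_r=\dots=\lambda_d$ and corresponding orthonormal eigenvectors $q_1,\dots,q_d$. Let $f_{\mathrm{RQ}}(x)=x^\top Ax$, $Q=[q_r,q_{r+1},\dots,q_d]$, and, for $\alpha>0$, $\mathcal S_\alpha=\{x\in\mathbb{S}^{d-1}:\|Q^\top x\|_2\ge\alpha\}$. Let $$\mu=\alpha\sqrt{\frac{\lambda_{r-1}-\lambda_d}{\lambda_1-\lambda_d}} .$$ Then for any $x\in\mathcal S_\alpha$, $f_{\mathrm{RQ}}$ is $\mu$-RGA at $(x,x^*(x))$, where $x^*(x)=QQ^\top x/\|QQ^\top x\|_2$ is the normalized projection of $x$ onto $\mathrm{Span}(q_r,\dots,q_d)$.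
   Context: $\mathbb{S}^{d-1}$ is the unit sphere of $\mathbb{R}^d$; $\theta(x,y)=\arccos(x\cdot y)$ for unit vectors. The Riemannian gradient of $f$ is $\nabla^Rf(x)=(I-xx^\top)\nabla f(x)$. A differentiable $f$ is $\mu$-RGA at $(x,x^* )$ if $\nabla^Rf(x)\neq0$ whenever $x\neq x^*$, and $\nabla^Rf(x)\cdot x^*\le-\mu\,\sin(\theta(x,x^* ))\,\|\nabla^Rf(x)\|_2$. *)

theory Defs
  imports "HOL-Analysis.Analysis"
begin

section \<open>Riemannian gradient on the sphere and the RGA property\<close>

text \<open>The Euclidean gradient; at a point where \<open>f\<close> is not differentiable the value is
  unspecified.\<close>

definition grad :: "(real ^ 'n \<Rightarrow> real) \<Rightarrow> real ^ 'n \<Rightarrow> real ^ 'n" where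
  "grad f x = (THE D. GDERIV f x :> D)"

lemma grad_eqI:
  assumes "GDERIV f x :> D"
  shows "grad f x = D"
  unfolding grad_def
proof (rule the_equality)
  show "GDERIV f x :> D" by (fact assms)
next
  fix E assume "GDERIV f x :> E"
  then have "(\<lambda>h. inner h E) = (\<lambda>h. inner h D)"
    using assms has_derivative_unique unfolding gderiv_def by blast
  then have "inner (E - D) E = inner (E - D) D" by metis
  then have "inner (E - D) (E - D) = 0" by (simp add: inner_diff_right)
  then show "E = D" by simp
qed

definition outer :: "real ^ 'n \<Rightarrow> real ^ 'm \<Rightarrow> real ^ 'm ^ 'n" where
  "outer x y = (\<chi> i j. x $ i * y $ j)"

definition riem_grad :: "(real ^ 'n \<Rightarrow> real) \<Rightarrow> real ^ 'n \<Rightarrow> real ^ 'n" where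
  "riem_grad f x = (mat 1 - outer x x) *v grad f x"

definition angle :: "real ^ 'n \<Rightarrow> real ^ 'n \<Rightarrow> real" where
  "angle x y = arccos (x \<bullet> y)"

text \<open>Both points are required to lie on the unit sphere, since \<^const>\<open>angle\<close> is meant for
  unit vectors only.\<close>

definition RGA :: "real \<Rightarrow> (real ^ 'n \<Rightarrow> real) \<Rightarrow> real ^ 'n \<Rightarrow> real ^ 'n \<Rightarrow> bool" where
  "RGA \<mu> f x xs \<longleftrightarrow>
     (\<forall>y. f differentiable (at y)) \<and> x \<in> sphere 0 1 \<and> xs \<in> sphere 0 1 \<and>
     (x \<noteq> xs \<longrightarrow> riem_grad f x \<noteq> 0) \<and>
     riem_grad f x \<bullet> xs \<le> - \<mu> * sin (angle x xs) * norm (riem_grad f x)"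

definition f_RQ :: "real ^ 'n ^ 'n \<Rightarrow> real ^ 'n \<Rightarrow> real" where
  "f_RQ A x = x \<bullet> (A *v x)"

section \<open>Matrices with columns indexed by a finite set\<close>

text \<open>The number of columns of \<open>Q = [q\<^sub>r, \<dots>, q\<^sub>d]\<close> depends on \<open>r\<close>, which is a term and not a
  type. Hence \<open>Q\<close> is represented by the family \<open>q\<close> of its columns together with the index set
  \<open>J = {r..d}\<close>. The vector \<open>Q\<^sup>T x\<close> is a function on \<open>J\<close>, whose Euclidean norm is
  \<^term>\<open>L2_set (cols_transpose_mult q x) J\<close>. The lemma \<open>cols_mult_matrix\<close> below relates this to
  genuine matrices.\<close>

definition cols_transpose_mult :: "('i \<Rightarrow> real ^ 'n) \<Rightarrow> real ^ 'n \<Rightarrow> 'i \<Rightarrow> real" where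
  "cols_transpose_mult q x = (\<lambda>j. q j \<bullet> x)"

definition cols_mult :: "('i \<Rightarrow> real ^ 'n) \<Rightarrow> 'i set \<Rightarrow> ('i \<Rightarrow> real) \<Rightarrow> real ^ 'n" where
  "cols_mult q J y = (\<Sum>j\<in>J. y j *\<^sub>R q j)"

lemma cols_mult_matrix:
  fixes Q :: "real ^ 'm ^ 'n" and q :: "'i \<Rightarrow> real ^ 'n" and e :: "'m \<Rightarrow> 'i"
  assumes e: "bij_betw e UNIV J" and Q: "\<And>k. column k Q = q (e k)"
  shows "norm (transpose Q *v x) = L2_set (cols_transpose_mult q x) J"
    and "Q *v (transpose Q *v x) = cols_mult q J (cols_transpose_mult q x)"
proof -
  have *: "(transpose Q *v x) $ k = cols_transpose_mult q x (e k)" for k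
    unfolding cols_transpose_mult_def Q[symmetric]
    by (simp add: matrix_vector_mult_def transpose_def column_def inner_vec_def)
  have "(\<Sum>k\<in>UNIV. (cols_transpose_mult q x (e k))\<^sup>2) = (\<Sum>j\<in>J. (cols_transpose_mult q x j)\<^sup>2)"
    by (rule sum.reindex_bij_betw[OF e])
  then show "norm (transpose Q *v x) = L2_set (cols_transpose_mult q x) J"
    unfolding norm_vec_def L2_set_def by (simp only: * real_norm_def power2_abs)
  have "Q *v (transpose Q *v x) = (\<Sum>k\<in>UNIV. (transpose Q *v x) $ k *s column k Q)"
    by (rule matrix_mult_sum)
  also have "\<dots> = (\<Sum>k\<in>UNIV. cols_transpose_mult q x (e k) *\<^sub>R q (e k))"
    by (simp only: * Q scalar_mult_eq_scaleR)
  also have "\<dots> = cols_mult q J (cols_transpose_mult q x)"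
    unfolding cols_mult_def by (rule sum.reindex_bij_betw[OF e])
  finally show "Q *v (transpose Q *v x) = cols_mult q J (cols_transpose_mult q x)" .
qed

definition S_set :: "(nat \<Rightarrow> real ^ 'n) \<Rightarrow> nat \<Rightarrow> real \<Rightarrow> (real ^ 'n) set" where
  "S_set q r \<alpha> = {x \<in> sphere 0 1. L2_set (cols_transpose_mult q x) {r..CARD('n)} \<ge> \<alpha>}"

definition proj :: "(nat \<Rightarrow> real ^ 'n) \<Rightarrow> nat \<Rightarrow> real ^ 'n \<Rightarrow> real ^ 'n" where
  "proj q r x = cols_mult q {r..CARD('n)} (cols_transpose_mult q x)"

definition x_star :: "(nat \<Rightarrow> real ^ 'n) \<Rightarrow> nat \<Rightarrow> real ^ 'n \<Rightarrow> real ^ 'n" where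
  "x_star q r x = proj q r x /\<^sub>R norm (proj q r x)"

lemma proj_closest_point:
  fixes q :: "nat \<Rightarrow> real ^ 'n"
  assumes orth: "\<forall>i\<in>{r..CARD('n)}. \<forall>j\<in>{r..CARD('n)}. q i \<bullet> q j = (if i = j then 1 else 0)"
  shows "proj q r x = closest_point (span (q ` {r..CARD('n)})) x"
proof (rule closest_point_unique)
  let ?J = "{r..CARD('n)}" and ?V = "span (q ` {r..CARD('n)})" and ?p = "proj q r x"
  show "convex ?V" "closed ?V"
    by (simp_all add: subspace_imp_convex closed_subspace)
  show p: "?p \<in> ?V"
    unfolding proj_def cols_mult_def by (intro span_sum span_scale span_base imageI)
  have "orthogonal (x - ?p) b" if "b \<in> q ` ?J" for b
  proof -
    from that obtain i where i: "i \<in> ?J" "b = q i" by blast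
    have "?p \<bullet> q i = (\<Sum>j\<in>?J. (q j \<bullet> x) * (q j \<bullet> q i))"
      by (simp add: proj_def cols_mult_def cols_transpose_mult_def inner_sum_left)
    also have "\<dots> = (\<Sum>j\<in>?J. if j = i then q j \<bullet> x else 0)"
      using orth i by (intro sum.cong) auto
    also have "\<dots> = q i \<bullet> x" using i by simp
    finally show ?thesis
      unfolding i orthogonal_def inner_diff_left by (simp add: inner_commute)
  qed
  then have perp: "orthogonal (x - ?p) v" if "v \<in> ?V" for v
    using that orthogonal_to_span by blast
  show "\<forall>z\<in>?V. dist x ?p \<le> dist x z"
  proof
    fix z assume "z \<in> ?V"
    with p have "orthogonal (x - ?p) (?p - z)" by (intro perp span_diff)
    then have "(norm (x - z))\<^sup>2 = (norm (x - ?p))\<^sup>2 + (norm (?p - z))\<^sup>2"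
      using norm_add_Pythagorean[of "x - ?p" "?p - z"] by simp
    then have "(norm (x - ?p))\<^sup>2 \<le> (norm (x - z))\<^sup>2" by simp
    then show "dist x ?p \<le> dist x z"
      unfolding dist_norm by (rule power2_le_imp_le) simp
  qed
qed

end

theory Submission
  imports Defs
begin

text \<open>Write \<open>d\<close> for the dimension, \<open>p\<close> for the projection of the unit vector \<open>x\<close> onto the bottom
  eigenspace, \<open>c = \<parallel>p\<parallel> = \<parallel>Q\<^sup>T x\<parallel> \<ge> \<alpha>\<close>, and \<open>B = A - \<lambda>\<^sub>d I\<close>, so that \<open>B\<close> is positive semidefinite
  and \<open>B p = 0\<close>. With \<open>s = x \<bullet> B x\<close>, the Riemannian gradient at \<open>x\<close> is \<open>2 g\<close> where
  \<open>g = B x - s x\<close> (the multiple of the identity cancels in the tangential part).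
  Since \<open>B x \<bullet> p = 0\<close> and \<open>x \<bullet> p = c\<^sup>2\<close>, one gets \<open>g \<bullet> p = - s c\<^sup>2\<close>, that is \<open>g \<bullet> x\<^sup>* = - s c\<close>, and
  also \<open>x \<bullet> x\<^sup>* = c\<close>, whose angle has sine \<open>\<surd>(1 - c\<^sup>2)\<close>.

  Expanding in the eigenbasis gives two bounds. First, \<open>\<parallel>g\<parallel>\<^sup>2 = \<parallel>B x\<parallel>\<^sup>2 - s\<^sup>2 \<le> (\<lambda>\<^sub>1 - \<lambda>\<^sub>d) s\<close>,
  because the eigenvalues of \<open>B\<close> are at most \<open>\<lambda>\<^sub>1 - \<lambda>\<^sub>d\<close>. Second,
  \<open>s \<ge> (\<lambda>\<^sub>r\<^sub>-\<^sub>1 - \<lambda>\<^sub>d) (1 - c\<^sup>2)\<close>, because the mass of \<open>x\<close> outside the bottom eigenspace is \<open>1 - c\<^sup>2\<close>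
  and \<open>B\<close> is at least \<open>\<lambda>\<^sub>r\<^sub>-\<^sub>1 - \<lambda>\<^sub>d\<close> there. Multiplying them
  and using \<open>\<alpha> \<le> c\<close>, one gets \<open>\<mu>\<^sup>2 (1 - c\<^sup>2) \<parallel>g\<parallel>\<^sup>2 \<le> c\<^sup>2 s\<^sup>2\<close>, which is the required inequality. If \<open>g = 0\<close> then
  \<open>s c\<^sup>2 = 0\<close>, so \<open>s = 0\<close>, so \<open>c = 1\<close> by the second bound, which means \<open>x = x\<^sup>*\<close>.\<close>

lemma orthonormal_basis_parseval:
  fixes q :: "'i \<Rightarrow> 'a::euclidean_space"
  assumes card: "finite I" "card I = DIM('a)"
    and orth: "\<And>i j. i \<in> I \<Longrightarrow> j \<in> I \<Longrightarrow> q i \<bullet> q j = (if i = j then 1 else 0)"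
  shows "x \<bullet> y = (\<Sum>i\<in>I. (q i \<bullet> x) * (q i \<bullet> y))"
proof -
  have nz: "q i \<noteq> 0" if "i \<in> I" for i
    using orth[OF that that] by auto
  have inj: "inj_on q I"
    using orth by (intro inj_onI) (metis zero_neq_one)
  have "pairwise orthogonal (q ` I)"
    unfolding pairwise_def orthogonal_def using orth by auto
  then have indep: "independent (q ` I)"
    using nz by (intro pairwise_orthogonal_independent) auto
  then have span: "span (q ` I) = UNIV"
    using card inj by (metis card_image dim_eq_full dim_eq_card)
  let ?y = "\<Sum>i\<in>I. (q i \<bullet> y) *\<^sub>R q i"
  have "orthogonal (y - ?y) b" if "b \<in> q ` I" for b
  proof -
    from that obtain j where j: "j \<in> I" "b = q j" by blast
    have "?y \<bullet> q j = (\<Sum>i\<in>I. if i = j then q i \<bullet> y else 0)"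
      unfolding inner_sum_left using orth j by (intro sum.cong) auto
    also have "\<dots> = q j \<bullet> y"
      using j card by simp
    finally show ?thesis
      unfolding j orthogonal_def inner_diff_left by (simp add: inner_commute)
  qed
  then have "orthogonal (y - ?y) (y - ?y)"
    by (intro orthogonal_to_span[of "y - ?y" "q ` I"]) (simp_all only: span UNIV_I)
  then have "y = ?y"
    by (simp add: orthogonal_self)
  then have "x \<bullet> y = x \<bullet> ?y"
    by simp
  also have "\<dots> = (\<Sum>i\<in>I. (q i \<bullet> x) * (q i \<bullet> y))"
    by (simp add: inner_sum_right inner_commute mult.commute)
  finally show ?thesis .
qed

lemma GDERIV_f_RQ:
  fixes A :: "real ^ 'n ^ 'n"
  assumes sym: "transpose A = A"
  shows "GDERIV (f_RQ A) x :> 2 *\<^sub>R (A *v x)"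
proof -
  have lin: "((\<lambda>y. A *v y) has_derivative (\<lambda>h. A *v h)) (at x)"
    by (intro bounded_linear_imp_has_derivative) simp
  have "((\<lambda>y. y \<bullet> (A *v y)) has_derivative (\<lambda>h. x \<bullet> (A *v h) + h \<bullet> (A *v x))) (at x)"
    by (rule has_derivative_inner[OF has_derivative_ident lin])
  moreover have "x \<bullet> (A *v h) = h \<bullet> (A *v x)" for h
    using sym by (metis dot_lmul_matrix inner_commute transpose_matrix_vector)
  ultimately show ?thesis
    by (simp add: gderiv_def f_RQ_def[abs_def])
qed

lemma outer_mult_vector: "outer x y *v z = (y \<bullet> z) *\<^sub>R x"
  by (simp add: outer_def matrix_vector_mult_def inner_vec_def vec_eq_iff sum_distrib_left mult_ac)

lemma riem_grad_f_RQ: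
  assumes "transpose A = A"
  shows "riem_grad (f_RQ A) x = 2 *\<^sub>R (A *v x - (x \<bullet> (A *v x)) *\<^sub>R x)"
  unfolding riem_grad_def grad_eqI[OF GDERIV_f_RQ[OF assms]]
  by (simp add: matrix_vector_mult_diff_rdistrib outer_mult_vector scaleR_diff_right)

theorem theorem5p22:
  fixes A :: "real ^ 'n ^ 'n"
    and lam :: "nat \<Rightarrow> real"
    and q :: "nat \<Rightarrow> real ^ 'n"
    and r :: nat
    and \<alpha> \<mu> :: real
  assumes sym: "transpose A = A"
    and r: "2 \<le> r" "r \<le> CARD('n)"
    and eigvec: "\<forall>i\<in>{1..CARD('n)}. A *v q i = lam i *\<^sub>R q i"
    and orthonormal: "\<forall>i\<in>{1..CARD('n)}. \<forall>j\<in>{1..CARD('n)}. q i \<bullet> q j = (if i = j then 1 else 0)"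
    and decreasing: "\<forall>i\<in>{1..CARD('n)}. \<forall>j\<in>{1..CARD('n)}. i \<le> j \<longrightarrow> lam j \<le> lam i"
    and gap: "lam (r - 1) > lam r"
    and bottom: "\<forall>i\<in>{r..CARD('n)}. lam i = lam (CARD('n))"
    and alpha: "\<alpha> > 0"
    and mu: "\<mu> = \<alpha> * sqrt ((lam (r - 1) - lam (CARD('n))) / (lam 1 - lam (CARD('n))))"
  shows "\<forall>x \<in> S_set q r \<alpha>. RGA \<mu> (f_RQ A) x (x_star q r x)"
proof
  fix x assume "x \<in> S_set q r \<alpha>"
  then have x1: "norm x = 1" and
    L2: "\<alpha> \<le> L2_set (cols_transpose_mult q x) {r..CARD('n)}"
    by (auto simp: S_set_def)
  define l where "l = lam (CARD('n))"
  define p where "p = proj q r x"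
  define c where "c = norm p"
  define b where "b = A *v x - l *\<^sub>R x"
  define s where "s = x \<bullet> b"
  define g where "g = b - s *\<^sub>R x"
  let ?I = "{1..CARD('n)}" and ?J = "{r..CARD('n)}"
  have lam_bottom: "lam j = l" if "j \<in> ?J" for j
    unfolding l_def by (rule bspec[OF bottom that])
  have lam_mono: "lam j \<le> lam i" if "1 \<le> i" "i \<le> j" "j \<le> CARD('n)" for i j
    using decreasing that by auto
  have JI: "?J \<subseteq> ?I" using r by auto
  have parseval: "u \<bullet> v = (\<Sum>i\<in>?I. (q i \<bullet> u) * (q i \<bullet> v))" for u v
    using orthonormal by (intro orthonormal_basis_parseval) auto
  have xx: "x \<bullet> x = 1"
    using x1 by (simp add: dot_square_norm)

  have qb: "q i \<bullet> b = (lam i - l) * (q i \<bullet> x)" if "i \<in> ?I" for i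
  proof -
    have "q i \<bullet> (A *v x) = (A *v q i) \<bullet> x"
      using sym by (metis dot_lmul_matrix transpose_matrix_vector)
    also have "\<dots> = lam i * (q i \<bullet> x)"
      using eigvec that by simp
    finally show ?thesis
      by (simp add: b_def inner_diff_right algebra_simps)
  qed
  have p_sum: "p = (\<Sum>j\<in>?J. (q j \<bullet> x) *\<^sub>R q j)"
    by (simp add: p_def proj_def cols_mult_def cols_transpose_mult_def)
  have p_inner: "p \<bullet> v = (\<Sum>j\<in>?J. (q j \<bullet> x) * (q j \<bullet> v))" for v
    by (simp add: p_sum inner_sum_left)
  have qp: "q j \<bullet> p = q j \<bullet> x" if "j \<in> ?J" for j
  proof -
    have "q j \<bullet> p = (\<Sum>i\<in>?J. if i = j then q i \<bullet> x else 0)"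
      unfolding p_sum inner_sum_right using orthonormal that JI by (intro sum.cong) auto
    also have "\<dots> = q j \<bullet> x" using that by simp
    finally show ?thesis .
  qed
  have c2: "c\<^sup>2 = (\<Sum>j\<in>?J. (q j \<bullet> x)\<^sup>2)"
    unfolding c_def power2_norm_eq_inner p_inner using qp by (simp add: power2_eq_square)
  have px: "p \<bullet> x = c\<^sup>2"
    unfolding c2 p_inner by (simp add: power2_eq_square)
  have pb: "p \<bullet> b = 0"
    unfolding p_inner
  proof (rule sum.neutral, rule ballI)
    fix j assume j: "j \<in> ?J"
    with JI qb[of j] lam_bottom[OF j] show "(q j \<bullet> x) * (q j \<bullet> b) = 0" by auto
  qed
  have "c = L2_set (cols_transpose_mult q x) ?J"
    unfolding L2_set_def cols_transpose_mult_def using c2 by (simp add: c_def real_sqrt_unique)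
  with L2 alpha have c: "\<alpha> \<le> c" "0 < c" by auto
  have c1: "c \<le> 1"
  proof -
    have "c * c = p \<bullet> x" using px by (simp add: power2_eq_square)
    also have "\<dots> \<le> norm p * norm x" by (rule norm_cauchy_schwarz)
    finally show ?thesis using c(2) x1 by (simp add: c_def)
  qed
  then have c21: "c\<^sup>2 \<le> 1" using c by (simp add: power_le_one)

  \<comment> \<open>\<open>\<Lambda>\<close> bounds \<open>B\<close> from above, and \<open>\<delta>\<close> bounds it from below on the orthogonal
    complement of the bottom eigenspace.\<close>
  define \<delta> where "\<delta> = lam (r - 1) - l"
  define \<Lambda> where "\<Lambda> = lam 1 - l"
  have d_pos: "0 < \<delta>"
    using gap lam_bottom[of r] r by (simp add: \<delta>_def)
  have "\<delta> \<le> \<Lambda>"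
    using lam_mono[of 1 "r - 1"] r by (simp add: \<delta>_def \<Lambda>_def)
  with d_pos have L_pos: "0 < \<Lambda>" by simp
  have lam_range: "0 \<le> lam i - l" "lam i - l \<le> \<Lambda>" if "i \<in> ?I" for i
    using lam_mono[of i "CARD('n)"] lam_mono[of 1 i] that by (auto simp: l_def \<Lambda>_def)
  have lam_top: "\<delta> \<le> lam i - l" if "i \<in> ?I - ?J" for i
    using lam_mono[of i "r - 1"] that r by (auto simp: \<delta>_def)

  have s_sum: "s = (\<Sum>i\<in>?I. (lam i - l) * (q i \<bullet> x)\<^sup>2)"
    unfolding s_def parseval[of x b] by (intro sum.cong) (auto simp: qb power2_eq_square)
  have s_lower: "\<delta> * (1 - c\<^sup>2) \<le> s"
  proof -
    have "1 = (\<Sum>i\<in>?I. (q i \<bullet> x)\<^sup>2)"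
      using parseval[of x x] xx by (simp add: power2_eq_square)
    then have "\<delta> * (1 - c\<^sup>2) = (\<Sum>i\<in>?I - ?J. \<delta> * (q i \<bullet> x)\<^sup>2)"
      using JI by (simp add: c2 sum_diff right_diff_distrib flip: sum_distrib_left)
    also have "\<dots> \<le> (\<Sum>i\<in>?I - ?J. (lam i - l) * (q i \<bullet> x)\<^sup>2)"
      using lam_top by (intro sum_mono mult_right_mono) auto
    also have "\<dots> \<le> s"
      unfolding s_sum using lam_range by (intro sum_mono2) auto
    finally show ?thesis .
  qed
  have s_nonneg: "0 \<le> s"
    unfolding s_sum using lam_range by (intro sum_nonneg mult_nonneg_nonneg) auto
  have bb: "b \<bullet> b \<le> \<Lambda> * s"
  proof -
    have "b \<bullet> b = (\<Sum>i\<in>?I. (lam i - l) * ((lam i - l) * (q i \<bullet> x)\<^sup>2))"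
      unfolding parseval[of b b] by (intro sum.cong) (auto simp: qb power2_eq_square)
    also have "\<dots> \<le> (\<Sum>i\<in>?I. \<Lambda> * ((lam i - l) * (q i \<bullet> x)\<^sup>2))"
      using lam_range by (intro sum_mono mult_right_mono mult_nonneg_nonneg) auto
    also have "\<dots> = \<Lambda> * s" by (simp add: s_sum sum_distrib_left)
    finally show ?thesis .
  qed

  have "g \<bullet> g = b \<bullet> b - s\<^sup>2"
    using xx by (simp add: g_def s_def inner_diff_left inner_diff_right inner_commute power2_eq_square)
  with bb have "g \<bullet> g \<le> \<Lambda> * s" by (smt (verit) zero_le_power2)
  then have gg: "(norm g)\<^sup>2 \<le> \<Lambda> * s" by (simp add: power2_norm_eq_inner)
  have rg: "riem_grad (f_RQ A) x = 2 *\<^sub>R g"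
    using xx by (simp add: riem_grad_f_RQ[OF sym] g_def b_def s_def inner_diff_right algebra_simps)
  have pg: "p \<bullet> g = - s * c\<^sup>2"
    by (simp add: g_def inner_diff_right pb px)
  define xs where "xs = x_star q r x"
  have xs: "xs = p /\<^sub>R c"
    by (simp add: xs_def x_star_def p_def c_def)
  have norm_xs: "norm xs = 1"
    using c(2) by (simp add: xs c_def)
  have x_xs: "x \<bullet> xs = c"
    using px c(2) by (simp add: xs inner_commute power2_eq_square)
  have g_xs: "g \<bullet> xs = - s * c"
    using pg c(2) by (simp add: xs inner_commute power2_eq_square)
  have sin: "sin (angle x xs) = sqrt (1 - c\<^sup>2)"
    unfolding angle_def x_xs using c c1 by (intro sin_arccos) auto

  have mu_eq: "\<mu> = \<alpha> * sqrt (\<delta> / \<Lambda>)"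
    by (simp only: mu \<delta>_def \<Lambda>_def l_def)
  have main: "\<mu> * sqrt (1 - c\<^sup>2) * norm g \<le> s * c"
  proof (rule power2_le_imp_le)
    have "(\<mu> * sqrt (1 - c\<^sup>2) * norm g)\<^sup>2 = \<mu>\<^sup>2 * (1 - c\<^sup>2) * (norm g)\<^sup>2"
      using c21 by (simp add: power_mult_distrib)
    also have "\<mu>\<^sup>2 = \<alpha>\<^sup>2 * (\<delta> / \<Lambda>)"
      using d_pos L_pos by (simp add: mu_eq power_mult_distrib)
    also have "\<alpha>\<^sup>2 * (\<delta> / \<Lambda>) * (1 - c\<^sup>2) * (norm g)\<^sup>2 \<le> c\<^sup>2 * (\<delta> / \<Lambda>) * (1 - c\<^sup>2) * (\<Lambda> * s)"
      using alpha c c21 d_pos L_pos gg by (intro mult_mono power_mono) auto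
    also have "\<dots> = c\<^sup>2 * s * (\<delta> * (1 - c\<^sup>2))"
      using L_pos by simp
    also have "\<dots> \<le> c\<^sup>2 * s * s"
      using s_lower s_nonneg by (intro mult_left_mono) auto
    finally show "(\<mu> * sqrt (1 - c\<^sup>2) * norm g)\<^sup>2 \<le> (s * c)\<^sup>2"
      by (simp add: power2_eq_square mult_ac)
  qed (use s_nonneg c in auto)

  have nonzero: "riem_grad (f_RQ A) x \<noteq> 0" if "x \<noteq> xs"
  proof
    assume "riem_grad (f_RQ A) x = 0"
    then have "g = 0" by (simp add: rg)
    with g_xs c(2) have "s = 0" by auto
    with s_lower d_pos have "1 \<le> c\<^sup>2" by (simp add: mult_le_0_iff)
    then have "1 \<le> c" by (rule power2_le_imp_le[of 1 c, simplified]) (use c in simp)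
    with c1 have "c = 1" by simp
    \<comment> \<open>Equality in the Cauchy-Schwarz inequality.\<close>
    with x_xs have "x \<bullet> xs = norm x * norm xs" by (simp add: x1 norm_xs)
    then have "x = xs" unfolding norm_cauchy_schwarz_eq by (simp add: x1 norm_xs)
    with that show False by simp
  qed
  have diff: "f_RQ A differentiable (at y)" for y
    using GDERIV_f_RQ[OF sym, of y] by (auto simp: gderiv_def differentiable_def)
  have ineq: "riem_grad (f_RQ A) x \<bullet> xs \<le> - \<mu> * sin (angle x xs) * norm (riem_grad (f_RQ A) x)"
    using main g_xs by (simp add: rg sin)
  show "RGA \<mu> (f_RQ A) x (x_star q r x)"
    unfolding RGA_def xs_def[symmetric]
  proof (intro conjI allI impI)
    show "x \<in> sphere 0 1" "xs \<in> sphere 0 1"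
      by (simp_all add: x1 norm_xs)
  qed (fact diff nonzero ineq)+
qed

end
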